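(* Any triangulation $T$ of $\hat V$ admits pre-branchings, and hence compatible weak branchings (i.e. weak branchings inducing the given pre-branching).
   Context: $V$ is a compact oriented connected 3-manifold with (possibly empty) boundary made of tori; $\hat V$ is obtained by coning each boundary component. A triangulation $T$ of $\hat V$ is a finite collection of oriented tetrahedra $\Delta_1,\dots,\Delta_s$ with a complete system of pairings of their 2-faces by orientation-reversing affine isomorphisms, with oriented quotient homeomorphic to $\hat V$. A pre-branching of $T$ is a choice of co-orientation of the four 2-faces of each $\Delta_j$, two ingoing and two outgoing, such that the co-orientations match under the face pairings (an outgoing face is always paired with an ingoing face). A branching of an oriented tetrahedron is a total ordering of its vertices; it orients each 2-face by the order of its vertices, and the face is declared outgoing if this is its boundary orientation (outgoing normal first) and ingoing otherwise; exactly two faces are outgoing. A weak branching of $T$ is a choice of branching on each $\Delta_j$ such that the induced co-orientations of faces form a pre-branching of $T$. *)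

theory Defs
  imports "HOL-Analysis.Analysis" "HOL-Homology.Homology" "HOL-Combinatorics.Permutations"
begin

section \<open>Quotient spaces\<close>

definition generated_equiv :: "('a \<times> 'a) set \<Rightarrow> ('a \<times> 'a) set" where
  "generated_equiv r = (r \<union> r\<inverse>)\<^sup>*"

definition quotient_space :: "'a topology \<Rightarrow> ('a \<times> 'a) set \<Rightarrow> 'a set topology" where
  "quotient_space X r =
     topology (\<lambda>U. U \<subseteq> topspace X // generated_equiv r \<and> openin X (\<Union>U))"

text \<open>The next lemmas confirm that, for a relation on the points of \<open>X\<close>, this is the quotient
  topology: the points are the equivalence classes, and the projection is a quotient map.\<close>

lemma equiv_generated_equiv: "equiv UNIV (generated_equiv r)"
proof (rule equivI)
  show "sym (generated_equiv r)"
    unfolding generated_equiv_def by (intro sym_rtrancl sym_Un_converse)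
qed (auto simp: generated_equiv_def refl_rtrancl trans_rtrancl)

lemma generated_class_subset:
  assumes "r \<subseteq> A \<times> A" "x \<in> A"
  shows "generated_equiv r `` {x} \<subseteq> A"
proof
  fix y assume "y \<in> generated_equiv r `` {x}"
  then have "(x, y) \<in> (r \<union> r\<inverse>)\<^sup>*" by (simp add: generated_equiv_def)
  then show "y \<in> A" by (induction rule: rtrancl_induct) (use assms in auto)
qed

lemma istopology_quotient_space:
  "istopology (\<lambda>U. U \<subseteq> topspace X // generated_equiv r \<and> openin X (\<Union>U))"
  unfolding istopology_def
proof (rule conjI, safe)
  let ?E = "generated_equiv r"
  have disj: "P = Q \<or> P \<inter> Q = {}" if "P \<in> topspace X // ?E" "Q \<in> topspace X // ?E" for P Q
    using quotient_disj[OF equiv_generated_equiv, of P r Q] that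
    by (auto simp: quotient_def)
  fix S T assume ST: "S \<subseteq> topspace X // ?E" "openin X (\<Union>S)"
    "T \<subseteq> topspace X // ?E" "openin X (\<Union>T)"
  have "\<Union>(S \<inter> T) = \<Union>S \<inter> \<Union>T"
  proof
    show "\<Union>S \<inter> \<Union>T \<subseteq> \<Union>(S \<inter> T)"
    proof
      fix x assume "x \<in> \<Union>S \<inter> \<Union>T"
      then obtain P Q where PQ: "P \<in> S" "x \<in> P" "Q \<in> T" "x \<in> Q" by blast
      then have "P = Q" using disj[of P Q] ST by blast
      with PQ show "x \<in> \<Union>(S \<inter> T)" by blast
    qed
  qed blast
  then show "openin X (\<Union>(S \<inter> T))" using ST by (simp add: openin_Int)
next
  fix K assume K: "\<forall>S\<in>K. S \<subseteq> topspace X // generated_equiv r \<and> openin X (\<Union>S)"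
  have "\<Union>(\<Union>K) = (\<Union>S\<in>K. \<Union>S)" by blast
  moreover have "openin X (\<Union>S\<in>K. \<Union>S)" using K by (intro openin_Union) auto
  ultimately show "openin X (\<Union>(\<Union>K))" by simp
qed blast+

lemma openin_quotient_space:
  "openin (quotient_space X r) U \<longleftrightarrow>
     U \<subseteq> topspace X // generated_equiv r \<and> openin X (\<Union>U)"
  by (simp add: quotient_space_def topology_inverse'[OF istopology_quotient_space])

lemma
  assumes r: "r \<subseteq> topspace X \<times> topspace X"
  shows topspace_quotient_space: "topspace (quotient_space X r) = topspace X // generated_equiv r"
    and quotient_map_quotient_space:
      "quotient_map X (quotient_space X r) (\<lambda>x. generated_equiv r `` {x})"
proof -
  let ?E = "generated_equiv r"
  have refl: "x \<in> ?E `` {x}" for x by (simp add: generated_equiv_def)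
  have sub: "?E `` {x} \<subseteq> topspace X" if "x \<in> topspace X" for x
    using generated_class_subset[OF r that] .
  have "\<Union>(topspace X // ?E) = topspace X"
    unfolding quotient_def using refl sub by blast
  then have "openin (quotient_space X r) (topspace X // ?E)"
    by (simp add: openin_quotient_space)
  then show ts: "topspace (quotient_space X r) = topspace X // ?E"
    by (metis openin_quotient_space openin_subset openin_topspace subset_antisym)
  have "{x \<in> topspace X. ?E `` {x} \<in> U} = \<Union>U" if U: "U \<subseteq> topspace X // ?E" for U
  proof
    show "{x \<in> topspace X. ?E `` {x} \<in> U} \<subseteq> \<Union>U" using refl by blast
    show "\<Union>U \<subseteq> {x \<in> topspace X. ?E `` {x} \<in> U}"
    proof
      fix y assume "y \<in> \<Union>U"
      then obtain P where P: "P \<in> U" "y \<in> P" by blast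
      then obtain x where x: "x \<in> topspace X" "P = ?E `` {x}"
        using U unfolding quotient_def by blast
      have "?E `` {x} = ?E `` {y}"
        using P x equiv_class_eq[OF equiv_generated_equiv, of x y r] by auto
      then show "y \<in> {x \<in> topspace X. ?E `` {x} \<in> U}"
        using P x sub by auto
    qed
  qed
  then show "quotient_map X (quotient_space X r) (\<lambda>x. ?E `` {x})"
    unfolding quotient_map_def ts by (auto simp: openin_quotient_space quotient_def)
qed

section \<open>Compact oriented 3-manifolds with toric boundary\<close>

definition halfspace3 :: "(real^3) set" where
  "halfspace3 = {x. 0 \<le> x $ 1}"

definition manifold3 :: "'a topology \<Rightarrow> bool" where
  "manifold3 V \<longleftrightarrow> Hausdorff_space V \<and> second_countable V \<and>
     (\<forall>x\<in>topspace V. \<exists>U W. openin V U \<and> x \<in> U \<and> openin (top_of_set halfspace3) W \<and>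
        subtopology V U homeomorphic_space top_of_set W)"

definition manifold3_boundary :: "'a topology \<Rightarrow> 'a set" where
  "manifold3_boundary V = {x \<in> topspace V.
     \<exists>U W h. openin V U \<and> x \<in> U \<and> openin (top_of_set halfspace3) W \<and>
        homeomorphic_map (subtopology V U) (top_of_set W) h \<and> h x $ 1 = 0}"

definition manifold3_interior :: "'a topology \<Rightarrow> 'a set" where
  "manifold3_interior V = topspace V - manifold3_boundary V"

text \<open>An orientation is a continuous choice of generators of the local homology groups
  \<open>H\<^sub>3(V, V - {x})\<close> at the interior points.\<close>

definition manifold3_orientation :: "'a topology \<Rightarrow> ('a \<Rightarrow> 'a chain set) \<Rightarrow> bool" where
  "manifold3_orientation V \<mu> \<longleftrightarrow>
     (\<forall>x\<in>manifold3_interior V.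
        \<mu> x \<in> carrier (relative_homology_group 3 V (topspace V - {x})) \<and>
        generate (relative_homology_group 3 V (topspace V - {x})) {\<mu> x} =
          carrier (relative_homology_group 3 V (topspace V - {x})) \<and>
        (\<exists>U a. openin V U \<and> x \<in> U \<and> U \<subseteq> manifold3_interior V \<and>
           a \<in> carrier (relative_homology_group 3 V (topspace V - U)) \<and>
           (\<forall>y\<in>U. hom_induced 3 V (topspace V - U) V (topspace V - {y}) id a = \<mu> y)))"

definition boundary_components :: "'a topology \<Rightarrow> 'a set set" where
  "boundary_components V = connected_components_of (subtopology V (manifold3_boundary V))"

definition compact_oriented_toric_manifold3 ::
    "'a topology \<Rightarrow> ('a \<Rightarrow> 'a chain set) \<Rightarrow> bool" where
  "compact_oriented_toric_manifold3 V \<mu> \<longleftrightarrow>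
     manifold3 V \<and> compact_space V \<and> connected_space V \<and> manifold3_orientation V \<mu> \<and>
     (\<forall>C\<in>boundary_components V.
        subtopology V C homeomorphic_space prod_topology (nsphere 1) (nsphere 1))"

text \<open>Coning the boundary components: the cylinder \<open>\<partial>V \<times> [0,1]\<close> is attached to \<open>V = V \<times> {0}\<close>
  along \<open>\<partial>V \<times> {0}\<close>, and then \<open>C \<times> {1}\<close> is collapsed to a point for each component \<open>C\<close>
  of \<open>\<partial>V\<close>.\<close>

definition cone_relation :: "'a topology \<Rightarrow> (('a \<times> real) \<times> ('a \<times> real)) set" where
  "cone_relation V = {((x, 1), (y, 1)) | x y. \<exists>C\<in>boundary_components V. x \<in> C \<and> y \<in> C}"

definition coned_space :: "'a topology \<Rightarrow> ('a \<times> real) set topology" where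
  "coned_space V = quotient_space
     (subtopology (prod_topology V euclideanreal)
        (topspace V \<times> {0} \<union> manifold3_boundary V \<times> {0..1}))
     (cone_relation V)"

definition coned_inclusion :: "'a topology \<Rightarrow> 'a \<Rightarrow> ('a \<times> real) set" where
  "coned_inclusion V x = generated_equiv (cone_relation V) `` {(x, 0)}"

section \<open>Triangulations\<close>

text \<open>The tetrahedra are numbered by \<open>j < num_tets T\<close>; each is a copy of the standard 3-simplex,
  with vertices \<open>0, 1, 2, 3\<close>. The sign \<open>tet_sign T j\<close> is \<open>1\<close> if the orientation of the
  \<open>j\<close>-th tetrahedron is the one given by the ordering \<open>0, 1, 2, 3\<close> and \<open>-1\<close> otherwise. The face
  \<open>(j, v)\<close> is the 2-face of the \<open>j\<close>-th tetrahedron opposite to its vertex \<open>v\<close>. An affine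
  isomorphism between two faces is given by the bijection \<open>face_glue T F\<close> between their vertices.\<close>

record triangulation =
  num_tets :: nat
  tet_sign :: "nat \<Rightarrow> int"
  face_pair :: "nat \<times> nat \<Rightarrow> nat \<times> nat"
  face_glue :: "nat \<times> nat \<Rightarrow> nat \<Rightarrow> nat"

definition faces :: "triangulation \<Rightarrow> (nat \<times> nat) set" where
  "faces T = {..<num_tets T} \<times> {..3}"

definition face_vertices :: "nat \<times> nat \<Rightarrow> nat set" where
  "face_vertices F = {..3} - {snd F}"

text \<open>Sign of the permutation \<open>k \<mapsto> vs ! k\<close>, for \<open>vs\<close> listing \<open>0, 1, 2, 3\<close> in some order.\<close>

definition ordering_sign :: "nat list \<Rightarrow> int" where
  "ordering_sign vs = sign (\<lambda>k. if k < length vs then vs ! k else k)"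

text \<open>With the outgoing normal first, the vertices \<open>a, b, c\<close> of the face \<open>(j, v)\<close> are in positive
  order for the boundary orientation iff \<open>v, a, b, c\<close> is a positive ordering of the tetrahedron:
  the vector \<open>a - v\<close> points outwards, and the bases \<open>(a - v, b - v, c - v)\<close> and
  \<open>(a - v, b - a, c - a)\<close> have the same orientation.\<close>

definition boundary_positive :: "triangulation \<Rightarrow> nat \<times> nat \<Rightarrow> nat list \<Rightarrow> bool" where
  "boundary_positive T F vs \<longleftrightarrow> tet_sign T (fst F) * ordering_sign (snd F # vs) = 1"

definition face_gluing :: "triangulation \<Rightarrow> bool" where
  "face_gluing T \<longleftrightarrow>
     (\<forall>j<num_tets T. tet_sign T j \<in> {1, -1}) \<and>
     (\<forall>F\<in>faces T.
        face_pair T F \<in> faces T \<and> face_pair T F \<noteq> F \<and> face_pair T (face_pair T F) = F \<and>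
        bij_betw (face_glue T F) (face_vertices F) (face_vertices (face_pair T F)) \<and>
        (\<forall>v\<in>face_vertices F. face_glue T (face_pair T F) (face_glue T F v) = v) \<and>
        (\<forall>a b c. face_vertices F = {a, b, c} \<and> distinct [a, b, c] \<longrightarrow>
           (boundary_positive T (face_pair T F) (map (face_glue T F) [a, b, c]) \<longleftrightarrow>
             \<not> boundary_positive T F [a, b, c])))"

abbreviation simplex3 :: "(nat \<Rightarrow> real) topology" where
  "simplex3 \<equiv> subtopology (powertop_real UNIV) (standard_simplex 3)"

text \<open>The affine extension, in barycentric coordinates, of the vertex bijection.\<close>

definition affine_glue :: "triangulation \<Rightarrow> nat \<times> nat \<Rightarrow> (nat \<Rightarrow> real) \<Rightarrow> (nat \<Rightarrow> real)" where
  "affine_glue T F x = (\<lambda>w. \<Sum>v | v \<in> face_vertices F \<and> face_glue T F v = w. x v)"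

definition glue_relation ::
    "triangulation \<Rightarrow> ((nat \<times> (nat \<Rightarrow> real)) \<times> (nat \<times> (nat \<Rightarrow> real))) set" where
  "glue_relation T =
     {((fst F, x), (fst (face_pair T F), affine_glue T F x)) | F x.
        F \<in> faces T \<and> x \<in> standard_simplex 3 \<and> x (snd F) = 0}"

definition glued_space :: "triangulation \<Rightarrow> (nat \<times> (nat \<Rightarrow> real)) set topology" where
  "glued_space T =
     quotient_space (sum_topology (\<lambda>_. simplex3) {..<num_tets T}) (glue_relation T)"

definition tet_map :: "triangulation \<Rightarrow> nat \<Rightarrow> (nat \<Rightarrow> real) \<Rightarrow> (nat \<times> (nat \<Rightarrow> real)) set" where
  "tet_map T j x = generated_equiv (glue_relation T) `` {(j, x)}"

text \<open>A homeomorphism \<open>h\<close> from the glued space to the coned space is orientation preserving if, for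
  each tetrahedron and each point of its interior lying over an interior point \<open>y\<close> of \<open>V\<close>, the local
  homology class of the oriented tetrahedron, regarded as a singular simplex of the coned space,
  is the image of the local orientation \<open>\<mu> y\<close>. Points over the attached cylinders need no condition
  of their own: the complement of the cone points is a connected manifold containing the interior
  of \<open>V\<close>, so its orientation is determined there, and the gluings respect the orientations.\<close>

definition orientation_preserving ::
    "triangulation \<Rightarrow> 'a topology \<Rightarrow> ('a \<Rightarrow> 'a chain set) \<Rightarrow>
     ((nat \<times> (nat \<Rightarrow> real)) set \<Rightarrow> ('a \<times> real) set) \<Rightarrow> bool" where
  "orientation_preserving T V \<mu> h \<longleftrightarrow>
     (\<forall>j<num_tets T. \<forall>p\<in>standard_simplex 3. \<forall>y\<in>manifold3_interior V.
        (\<forall>i\<le>3. 0 < p i) \<and> h (tet_map T j p) = coned_inclusion V y \<longrightarrow>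
        homologous_rel_set 3 (coned_space V) (topspace (coned_space V) - {coned_inclusion V y})
          (frag_cmul (tet_sign T j)
             (frag_of (restrict (\<lambda>x. h (tet_map T j x)) (standard_simplex 3)))) =
        hom_induced 3 V (topspace V - {y})
          (coned_space V) (topspace (coned_space V) - {coned_inclusion V y})
          (coned_inclusion V) (\<mu> y))"

definition triangulates_coned ::
    "triangulation \<Rightarrow> 'a topology \<Rightarrow> ('a \<Rightarrow> 'a chain set) \<Rightarrow> bool" where
  "triangulates_coned T V \<mu> \<longleftrightarrow> face_gluing T \<and>
     (\<exists>h. homeomorphic_map (glued_space T) (coned_space V) h \<and> orientation_preserving T V \<mu> h)"

section \<open>Pre-branchings and weak branchings\<close>

datatype coorientation = Ingoing | Outgoing

definition pre_branching :: "triangulation \<Rightarrow> (nat \<times> nat \<Rightarrow> coorientation) \<Rightarrow> bool" where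
  "pre_branching T c \<longleftrightarrow>
     (\<forall>j<num_tets T. card {v \<in> {..3}. c (j, v) = Outgoing} = 2 \<and>
                     card {v \<in> {..3}. c (j, v) = Ingoing} = 2) \<and>
     (\<forall>F\<in>faces T. c F = Outgoing \<longleftrightarrow> c (face_pair T F) = Ingoing)"

text \<open>\<open>b j\<close> is the (reflexive) total order on the vertices of the \<open>j\<close>-th tetrahedron.\<close>

definition branching_coorientation ::
    "triangulation \<Rightarrow> (nat \<Rightarrow> nat rel) \<Rightarrow> nat \<times> nat \<Rightarrow> coorientation" where
  "branching_coorientation T b F =
     (if \<exists>x y z. face_vertices F = {x, y, z} \<and> distinct [x, y, z] \<and>
           (x, y) \<in> b (fst F) \<and> (y, z) \<in> b (fst F) \<and> boundary_positive T F [x, y, z]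
      then Outgoing else Ingoing)"

definition weak_branching :: "triangulation \<Rightarrow> (nat \<Rightarrow> nat rel) \<Rightarrow> bool" where
  "weak_branching T b \<longleftrightarrow>
     (\<forall>j<num_tets T. linear_order_on {..3} (b j)) \<and>
     pre_branching T (branching_coorientation T b)"

end

(* Pairing the faces 0, 1 and the faces 2, 3 of each tetrahedron gives a fixed-point-free involution
   of the set of faces, and the face pairing is another one. The union of two perfect matchings is
   bipartite, since its cycles alternate between them, and a 2-colouring is a pre-branching.
   Conversely, in the tetrahedron ordered v0 < v1 < v2 < v3 the face opposite to vk has coorientation
   (-1)^k times the sign of the ordering, so that two opposite edges {p, q} (outgoing) and {r, s}
   (ingoing) are realised by p < r < q < s or by q < r < p < s. *)
theory Submission
  imports Defs
begin

section \<open>Pre-branchings\<close>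

text \<open>Induction on \<open>A\<close>, removing one edge \<open>{x, f x}\<close> at a time. The
  map \<open>f\<close> restricts to what is left, while \<open>g\<close> may have to be rewired, so
  the induction is over all \<open>g\<close>. Contraction shortens an alternating cycle by two
  vertices and keeps its length even.\<close>

lemma two_involutions_coloring:
  assumes "finite A"
    and "\<And>x. x \<in> A \<Longrightarrow> f x \<in> A \<and> f x \<noteq> x \<and> f (f x) = x"
    and "\<And>x. x \<in> A \<Longrightarrow> g x \<in> A \<and> g x \<noteq> x \<and> g (g x) = x"
  shows "\<exists>c :: 'a \<Rightarrow> bool. \<forall>x\<in>A. c (f x) \<noteq> c x \<and> c (g x) \<noteq> c x"
  using assms
proof (induction A arbitrary: g rule: finite_psubset_induct)
  case (psubset A)
  note f = psubset.prems(1) and g = psubset.prems(2)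
  show ?case
  proof (cases "A = {}")
    case False
    then obtain x where x: "x \<in> A" by blast
    define y where "y = f x"
    define B where "B = A - {x, y}"
    have y: "y \<in> A" "y \<noteq> x" "f y = x" using f[OF x] by (auto simp: y_def)
    have B: "B \<subset> A" using x by (auto simp: B_def)
    have fB: "f z \<in> B \<and> f z \<noteq> z \<and> f (f z) = z" if "z \<in> B" for z
      using that f[of z] y y_def by (auto simp: B_def)
    show ?thesis
    proof (cases "g x = y")
      case True
      have gB: "g z \<in> B \<and> g z \<noteq> z \<and> g (g z) = z" if "z \<in> B" for z
        using that g[of z] g[OF x] True by (auto simp: B_def)
      from psubset.IH[OF B fB gB] obtain c :: "'a \<Rightarrow> bool" where
        c: "\<forall>z\<in>B. c (f z) \<noteq> c z \<and> c (g z) \<noteq> c z" by blast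
      \<comment> \<open>Here \<open>x\<close> and \<open>y\<close> form a component of their own, so
        any two opposite colours will do.\<close>
      let ?c = "c(x := True, y := False)"
      have "?c (f z) \<noteq> ?c z \<and> ?c (g z) \<noteq> ?c z" if "z \<in> A" for z
      proof (cases "z \<in> B")
        case True
        then show ?thesis using c fB[OF True] gB[OF True] by (auto simp: B_def)
      next
        case False
        then have "z = x \<or> z = y" using that by (auto simp: B_def)
        then show ?thesis using y y_def True g[OF x] by auto
      qed
      then show ?thesis by (intro exI[of _ ?c] ballI)
    next
      case False
      \<comment> \<open>Contract the path \<open>g x, x, y, g y\<close> to a single edge.\<close>
      define a b where "a = g x" and "b = g y"
      define h where "h = g(a := b, b := a)"
      have ab: "a \<in> B" "b \<in> B" "a \<noteq> b" "g a = x" "g b = y"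
        using g[OF x] g[OF y(1)] False y by (auto simp: B_def a_def b_def)
      have hB: "h z \<in> B \<and> h z \<noteq> z \<and> h (h z) = z" if "z \<in> B" for z
      proof (cases "z = a \<or> z = b")
        case True
        then show ?thesis using ab by (auto simp: h_def)
      next
        case False
        have z: "z \<in> A" "z \<noteq> x" "z \<noteq> y" using that by (auto simp: B_def)
        \<comment> \<open>As \<open>g\<close> is an involution, a value \<open>x\<close>,
          \<open>y\<close>, \<open>a\<close> or \<open>b\<close> at \<open>z\<close> would force
          \<open>z\<close> to be \<open>a\<close>, \<open>b\<close>, \<open>x\<close> or
          \<open>y\<close> respectively.\<close>
        have "g z \<noteq> x" "g z \<noteq> y" "g z \<noteq> a" "g z \<noteq> b"
          using False g[OF z(1)] z ab a_def b_def by metis+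
        then show ?thesis using False g[OF z(1)] by (auto simp: h_def B_def)
      qed
      from psubset.IH[OF B fB hB] obtain c :: "'a \<Rightarrow> bool" where
        c: "\<forall>z\<in>B. c (f z) \<noteq> c z \<and> c (h z) \<noteq> c z" by blast
      have cab: "c a \<noteq> c b" using bspec[OF c ab(1)] ab(3) by (auto simp: h_def)
      have fxy: "f x = y" "f y = x" and gxy: "g x = a" "g y = b"
        using y y_def a_def b_def by simp_all
      have nB: "x \<notin> B" "y \<notin> B" by (auto simp: B_def)
      have cf: "c (f a) \<noteq> c a" "c (f b) \<noteq> c b" and fab: "f a \<in> B" "f b \<in> B"
        using c fB ab(1,2) by blast+
      \<comment> \<open>The contracted edge gave \<open>a\<close> and \<open>b\<close> different
        colours, so undoing the contraction makes the colours alternate along \<open>a\<close>,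
        \<open>x\<close>, \<open>y\<close>, \<open>b\<close>.\<close>
      let ?c = "c(x := \<not> c a, y := \<not> c b)"
      have "?c (f z) \<noteq> ?c z \<and> ?c (g z) \<noteq> ?c z" if zA: "z \<in> A" for z
      proof -
        consider "z = x" | "z = y" | "z = a" | "z = b" | "z \<in> B" "z \<noteq> a" "z \<noteq> b"
          using zA unfolding B_def by blast
        then show ?thesis
        proof cases
          \<comment> \<open>Away from \<open>a\<close> and \<open>b\<close> the maps
            \<open>h\<close> and \<open>g\<close> agree, so nothing changes at
            \<open>z\<close>.\<close>
          case 5
          have "g z \<in> B" "f z \<in> B" "c (f z) \<noteq> c z" "c (g z) \<noteq> c z"
            using fB[OF 5(1)] hB[OF 5(1)] bspec[OF c 5(1)] 5(2,3) by (auto simp: h_def)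
          then show ?thesis using 5(1) nB by auto
        qed (use fxy gxy ab(4,5) cab cf fab nB ab(1,2) y(2) in auto)
      qed
      then show ?thesis by (intro exI[of _ ?c] ballI)
    qed
  qed simp
qed

lemma pre_branching_exists:
  assumes "face_gluing T"
  shows "\<exists>c. pre_branching T c"
proof -
  \<comment> \<open>Swaps 0 with 1 and 2 with 3. Opposite colours within each of the two pairs force
    exactly two outgoing and two ingoing faces in every tetrahedron.\<close>
  define m :: "nat \<Rightarrow> nat" where "m v = (if even v then v + 1 else v - 1)" for v
  have atMost3: "{..3} = {0, 1, 2, 3::nat}" by auto
  have "finite (faces T)" by (simp add: faces_def)
  moreover have "(fst F, m (snd F)) \<in> faces T \<and> (fst F, m (snd F)) \<noteq> F \<and>
      (fst (fst F, m (snd F)), m (snd (fst F, m (snd F)))) = F" if "F \<in> faces T" for F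
    using that by (cases F) (auto simp: faces_def m_def atMost3)
  moreover have "face_pair T F \<in> faces T \<and> face_pair T F \<noteq> F \<and> face_pair T (face_pair T F) = F"
    if "F \<in> faces T" for F
    using assms that by (simp add: face_gluing_def)
  ultimately obtain k :: "nat \<times> nat \<Rightarrow> bool" where
    k: "\<forall>F\<in>faces T. k (fst F, m (snd F)) \<noteq> k F \<and> k (face_pair T F) \<noteq> k F"
    using two_involutions_coloring[of "faces T" "\<lambda>F. (fst F, m (snd F))" "face_pair T"] by blast
  define c where "c F = (if k F then Outgoing else Ingoing)" for F
  have "card {v \<in> {..3}. c (j, v) = Outgoing} = 2 \<and> card {v \<in> {..3}. c (j, v) = Ingoing} = 2"
    if j: "j < num_tets T" for j
  proof -
    have k01: "k (j, 1) = (\<not> k (j, 0))" and k23: "k (j, 3) = (\<not> k (j, 2))"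
      using k[rule_format, of "(j, 0)"] k[rule_format, of "(j, 2)"] j
      by (auto simp: faces_def m_def)
    have "{v \<in> {..3}. c (j, v) = Outgoing} =
        {if k (j, 0) then 0 else 1, if k (j, 2) then 2 else 3}"
      "{v \<in> {..3}. c (j, v) = Ingoing} =
        {if k (j, 0) then 1 else 0, if k (j, 2) then 3 else 2}"
      using k01 k23 by (auto simp: c_def atMost3 split: if_splits)
    then show ?thesis by (auto simp: card_insert_if)
  qed
  moreover have "c F = Outgoing \<longleftrightarrow> c (face_pair T F) = Ingoing" if "F \<in> faces T" for F
    using k that by (auto simp: c_def)
  ultimately have "pre_branching T c" unfolding pre_branching_def by blast
  then show ?thesis by blast
qed

text \<open>Transfers the pre-branching condition from a given \<open>c\<close> to the coorientation
  induced by a branching, which is only known to agree with \<open>c\<close> on the faces of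
  \<open>T\<close>.\<close>

lemma pre_branching_cong:
  assumes "face_gluing T" and "\<And>F. F \<in> faces T \<Longrightarrow> c F = d F"
  shows "pre_branching T c \<longleftrightarrow> pre_branching T d"
proof -
  have "{v \<in> {..3}. c (j, v) = e} = {v \<in> {..3}. d (j, v) = e}" if "j < num_tets T" for j e
    using assms(2) that by (auto simp: faces_def)
  moreover have "face_pair T F \<in> faces T" if "F \<in> faces T" for F
    using assms(1) that by (simp add: face_gluing_def)
  ultimately show ?thesis using assms(2) by (simp add: pre_branching_def)
qed

section \<open>Weak branchings\<close>

text \<open>The list is read as increasing. Indices are compared non-strictly because
  \<open>linear_order_on\<close> asks for a reflexive relation.\<close>

definition list_order :: "'a list \<Rightarrow> 'a rel" where
  "list_order vs = {(vs ! i, vs ! k) | i k. i \<le> k \<and> k < length vs}"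

lemma linear_order_list_order:
  assumes "distinct vs"
  shows "linear_order_on (set vs) (list_order vs)"
proof -
  have le: "(vs ! i, vs ! k) \<in> list_order vs" if "i \<le> k" "k < length vs" for i k
    unfolding list_order_def using that by blast
  then have "refl_on (set vs) (list_order vs)"
    by (auto simp: refl_on_def in_set_conv_nth)
  moreover have "list_order vs \<subseteq> set vs \<times> set vs"
    by (auto simp: list_order_def)
  moreover have "trans (list_order vs)"
    using assms by (fastforce simp: trans_def list_order_def nth_eq_iff_index_eq)
  moreover have "antisym (list_order vs)"
    using assms by (fastforce simp: antisym_def list_order_def nth_eq_iff_index_eq)
  moreover have "total_on (set vs) (list_order vs)"
    unfolding total_on_def using le by (metis in_set_conv_nth nle_le)
  ultimately show ?thesis by (simp add: order_on_defs)
qed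

text \<open>Exchanging two entries composes the underlying permutation on the right with a
  transposition of positions.\<close>

lemma ordering_sign_swap:
  assumes "distinct vs" "set vs = {..<length vs}" "i < length vs" "k < length vs" "i \<noteq> k"
  shows "ordering_sign (vs[i := vs ! k, k := vs ! i]) = - ordering_sign vs"
proof -
  \<comment> \<open>Extension by the identity turns the list into a permutation of all natural
    numbers, to which \<open>sign\<close> applies.\<close>
  define p where "p = (\<lambda>n. if n < length vs then vs ! n else n)"
  have "bij_betw p {..<length vs} {..<length vs}"
    using bij_betw_nth[OF assms(1) refl assms(2)[symmetric]]
    by (rule bij_betw_cong[THEN iffD1, rotated]) (simp add: p_def)
  then have "p permutes {..<length vs}"
    by (intro bij_imp_permutes) (auto simp: p_def)
  then have p: "permutation p" using permutation_permutes by blast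
  have "(\<lambda>n. if n < length (vs[i := vs ! k, k := vs ! i])
      then vs[i := vs ! k, k := vs ! i] ! n else n) = p \<circ> Transposition.transpose i k"
    using assms by (auto simp: fun_eq_iff p_def Transposition.transpose_def nth_list_update)
  then have "ordering_sign (vs[i := vs ! k, k := vs ! i]) = sign p * sign (Transposition.transpose i k)"
    unfolding ordering_sign_def by (simp add: sign_compose[OF p] permutation_swap_id)
  then show ?thesis using assms(5) by (simp add: sign_swap_id ordering_sign_def p_def)
qed

text \<open>The existential in \<open>branching_coorientation\<close> ranges over increasing
  enumerations of the face. Antisymmetry leaves only one, so it suffices to test that one.\<close>

lemma branching_coorientation_ordered:
  assumes lin: "linear_order_on {..3} (b (fst F))"
    and F: "face_vertices F = {x, y, z}" "distinct [x, y, z]"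
    and ord: "(x, y) \<in> b (fst F)" "(y, z) \<in> b (fst F)"
  shows "branching_coorientation T b F =
    (if boundary_positive T F [x, y, z] then Outgoing else Ingoing)"
proof -
  have anti: "antisym (b (fst F))" and tr: "trans (b (fst F))"
    using lin by (auto simp: order_on_defs)
  have xz: "(x, z) \<in> b (fst F)" using tr ord by (meson transD)
  have not: "(y, x) \<notin> b (fst F)" "(z, y) \<notin> b (fst F)" "(z, x) \<notin> b (fst F)"
    using anti ord xz F(2) by (auto dest: antisymD)
  \<comment> \<open>Any other arrangement of three elements has a descent between neighbours, which
    \<open>not\<close> excludes.\<close>
  have "x' = x \<and> y' = y \<and> z' = z"
    if "{x, y, z} = {x', y', z'}" "distinct [x', y', z']"
      "(x', y') \<in> b (fst F)" "(y', z') \<in> b (fst F)" for x' y' z'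
  proof -
    have "x' \<in> {x, y, z}" "y' \<in> {x, y, z}" "z' \<in> {x, y, z}" using that(1) by auto
    then show ?thesis using that(2-4) not by auto
  qed
  then have "(\<exists>x' y' z'. face_vertices F = {x', y', z'} \<and> distinct [x', y', z'] \<and>
      (x', y') \<in> b (fst F) \<and> (y', z') \<in> b (fst F) \<and> boundary_positive T F [x', y', z']) \<longleftrightarrow>
      boundary_positive T F [x, y, z]"
    using F ord by (metis (no_types, lifting))
  then show ?thesis by (simp add: branching_coorientation_def)
qed

text \<open>Moving a vertex to the front past each smaller one flips the sign once, so
  coorientations alternate along the order; \<open>pos\<close> fixes the first as outgoing.\<close>

lemma branching_coorientation_list_order:
  assumes b: "b j = list_order [p, r, q, s]"
    and vs: "distinct [p, r, q, s]" "{p, r, q, s} = {..3}"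
    and pos: "tet_sign T j * ordering_sign [p, r, q, s] = 1"
  shows "branching_coorientation T b (j, p) = Outgoing"
    "branching_coorientation T b (j, r) = Ingoing"
    "branching_coorientation T b (j, q) = Outgoing"
    "branching_coorientation T b (j, s) = Ingoing"
proof -
  have lin: "linear_order_on {..3} (b j)"
    using linear_order_list_order[OF vs(1)] vs(2) b by simp
  have le: "([p, r, q, s] ! i, [p, r, q, s] ! k) \<in> b j" if "i \<le> k" "k < 4" for i k
    unfolding b list_order_def using that by (intro CollectI exI[of _ i] exI[of _ k]) simp
  have ord: "(p, r) \<in> b j" "(p, q) \<in> b j" "(r, q) \<in> b j" "(r, s) \<in> b j" "(q, s) \<in> b j"
    using le[of 0 1] le[of 0 2] le[of 1 2] le[of 1 3] le[of 2 3] by simp_all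
  have fv: "face_vertices (j, p) = {r, q, s}" "face_vertices (j, r) = {p, q, s}"
    "face_vertices (j, q) = {p, r, s}" "face_vertices (j, s) = {p, r, q}"
    using vs by (auto simp: face_vertices_def simp flip: vs(2))
  have card4: "{..<4} = {..3::nat}" by auto
  have swap: "ordering_sign (ws[i := ws ! k, k := ws ! i]) = - ordering_sign ws"
    if "distinct ws" "set ws = {p, r, q, s}" "length ws = 4" "i < 4" "k < 4" "i \<noteq> k" for ws i k
    using ordering_sign_swap[of ws i k] that vs(2) card4 by simp
  \<comment> \<open>Each list has the vertex opposite to the face in front and the others in
    increasing order; it arises from the previous list by one swap with the front entry.\<close>
  have r: "ordering_sign [r, p, q, s] = - ordering_sign [p, r, q, s]"
    using swap[of "[p, r, q, s]" 0 1] vs(1) by simp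
  have q: "ordering_sign [q, p, r, s] = - ordering_sign [r, p, q, s]"
    using swap[of "[r, p, q, s]" 0 2] vs(1) by (simp add: insert_commute)
  have s: "ordering_sign [s, p, r, q] = - ordering_sign [q, p, r, s]"
    using swap[of "[q, p, r, s]" 0 3] vs(1) by (simp add: insert_commute)
  show "branching_coorientation T b (j, p) = Outgoing"
    using branching_coorientation_ordered[of b "(j, p)" r q s T] lin fv ord vs(1) pos
    by (simp add: boundary_positive_def)
  show "branching_coorientation T b (j, r) = Ingoing"
    using branching_coorientation_ordered[of b "(j, r)" p q s T] lin fv ord vs(1) pos r
    by (simp add: boundary_positive_def)
  show "branching_coorientation T b (j, q) = Outgoing"
    using branching_coorientation_ordered[of b "(j, q)" p r s T] lin fv ord vs(1) pos r q
    by (simp add: boundary_positive_def)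
  show "branching_coorientation T b (j, s) = Ingoing"
    using branching_coorientation_ordered[of b "(j, s)" p r q T] lin fv ord vs(1) pos r q s
    by (simp add: boundary_positive_def)
qed

text \<open>Exchanging the two outgoing vertices reverses the sign of the order but keeps the
  alternating pattern, so one of the two orders matches \<open>tet_sign T j\<close>. Quantifying
  over every \<open>b\<close> with \<open>b j = R\<close> records that only the order on this
  tetrahedron matters, so that orders can be chosen independently.\<close>

lemma tetrahedron_branching:
  fixes c :: "nat \<times> nat \<Rightarrow> coorientation"
  assumes eps: "tet_sign T j \<in> {1, -1}"
    and out: "card {v \<in> {..3}. c (j, v) = Outgoing} = 2"
    and ing: "card {v \<in> {..3}. c (j, v) = Ingoing} = 2"
  shows "\<exists>R. linear_order_on {..3} R \<and>
    (\<forall>b v. b j = R \<longrightarrow> v \<le> 3 \<longrightarrow> branching_coorientation T b (j, v) = c (j, v))"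
    (is "\<exists>R. ?P R")
proof -
  obtain p q where pq: "{v \<in> {..3}. c (j, v) = Outgoing} = {p, q}" "p \<noteq> q"
    using out by (auto simp: card_2_iff)
  obtain r s where rs: "{v \<in> {..3}. c (j, v) = Ingoing} = {r, s}" "r \<noteq> s"
    using ing by (auto simp: card_2_iff)
  have c: "c (j, p) = Outgoing" "c (j, q) = Outgoing" "c (j, r) = Ingoing" "c (j, s) = Ingoing"
    using pq rs by blast+
  have "{p, r, q, s} = {v \<in> {..3}. c (j, v) = Outgoing} \<union> {v \<in> {..3}. c (j, v) = Ingoing}"
    unfolding pq rs by auto
  also have "\<dots> = {..3}" using coorientation.exhaust by blast
  finally have vs: "{p, r, q, s} = {..3}" .
  have dist: "distinct [p, r, q, s]" using c pq(2) rs(2) by auto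
  \<comment> \<open>Kept general in \<open>x\<close> and \<open>y\<close> to serve both for
    \<open>p\<close>, \<open>q\<close> and for \<open>q\<close>, \<open>p\<close>.\<close>
  have *: "?P (list_order [x, r, y, s])"
    if vs': "distinct [x, r, y, s]" "{x, r, y, s} = {..3}"
    and pos: "tet_sign T j * ordering_sign [x, r, y, s] = 1"
    and xy: "c (j, x) = Outgoing" "c (j, y) = Outgoing" for x y
  proof (intro conjI allI impI)
    show "linear_order_on {..3} (list_order [x, r, y, s])"
      using linear_order_list_order[OF vs'(1)] vs'(2) by simp
    fix b v assume b: "b j = list_order [x, r, y, s]" and "v \<le> (3::nat)"
    then have "v = x \<or> v = r \<or> v = y \<or> v = s" using vs'(2) by blast
    then show "branching_coorientation T b (j, v) = c (j, v)"
      using branching_coorientation_list_order[of b j x r y s T, OF b vs' pos] c(3,4) xy by metis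
  qed
  have "{..<length [p, r, q, s]} = {..3}" by auto
  then have "set [p, r, q, s] = {..<length [p, r, q, s]}" by (simp only: list.set vs)
  then have neg: "ordering_sign [q, r, p, s] = - ordering_sign [p, r, q, s]"
    using ordering_sign_swap[OF dist, of 0 2] by simp
  have "ordering_sign [p, r, q, s] = 1 \<or> ordering_sign [p, r, q, s] = -1"
    by (simp add: ordering_sign_def sign_def)
  then have "tet_sign T j * ordering_sign [p, r, q, s] = 1 \<or>
      tet_sign T j * ordering_sign [q, r, p, s] = 1"
    using eps neg by auto
  then show ?thesis
  proof
    assume "tet_sign T j * ordering_sign [p, r, q, s] = 1"
    from *[OF dist vs this c(1,2)] show ?thesis by blast
  next
    assume pos: "tet_sign T j * ordering_sign [q, r, p, s] = 1"
    have "distinct [q, r, p, s]" "{q, r, p, s} = {..3}" using dist vs by auto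
    from *[OF this pos c(2,1)] show ?thesis by blast
  qed
qed

text \<open>Orders are chosen one tetrahedron at a time; compatibility across glued faces is
  inherited from \<open>c\<close>.\<close>

lemma weak_branching_of_pre_branching:
  assumes T: "face_gluing T" and c: "pre_branching T c"
  shows "\<exists>b. weak_branching T b \<and> (\<forall>F\<in>faces T. branching_coorientation T b F = c F)"
proof -
  have "\<exists>R. linear_order_on {..3} R \<and>
      (\<forall>b v. b j = R \<longrightarrow> v \<le> 3 \<longrightarrow> branching_coorientation T b (j, v) = c (j, v))"
    if j: "j < num_tets T" for j
    using T c j by (intro tetrahedron_branching) (simp_all add: face_gluing_def pre_branching_def)
  then obtain b where b: "\<And>j. j < num_tets T \<Longrightarrow> linear_order_on {..3} (b j) \<and>
      (\<forall>b' v. b' j = b j \<longrightarrow> v \<le> 3 \<longrightarrow> branching_coorientation T b' (j, v) = c (j, v))"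
    by metis
  have eq: "branching_coorientation T b F = c F" if "F \<in> faces T" for F
  proof -
    have "fst F < num_tets T" "snd F \<le> 3" using that by (auto simp: faces_def)
    \<comment> \<open>The universally quantified \<open>b'\<close> is instantiated with the
      assembled family \<open>b\<close> itself.\<close>
    then have "branching_coorientation T b (fst F, snd F) = c (fst F, snd F)" using b by blast
    then show ?thesis by simp
  qed
  have "pre_branching T (branching_coorientation T b)"
    using c pre_branching_cong[OF T, of "branching_coorientation T b" c, OF eq] by simp
  then have "weak_branching T b" using b by (simp add: weak_branching_def)
  then show ?thesis using eq by blast
qed

theorem lemma2p10:
  fixes V :: "'a topology" and \<mu> :: "'a \<Rightarrow> 'a chain set" and T :: triangulation
  assumes "compact_oriented_toric_manifold3 V \<mu>"
    and "triangulates_coned T V \<mu>"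
  shows "(\<exists>c. pre_branching T c) \<and>
    (\<forall>c. pre_branching T c \<longrightarrow>
      (\<exists>b. weak_branching T b \<and> (\<forall>F\<in>faces T. branching_coorientation T b F = c F)))"
proof -
  have "face_gluing T" using assms(2) by (simp add: triangulates_coned_def)
  then show ?thesis using pre_branching_exists weak_branching_of_pre_branching by blast
qed

end
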